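(* Let $\vdash$ be a deductive relation on a dually integral Abelian pomonoid $\mathbf{R}=\langle R,\leq,+,0\rangle$. For $x\in R$ let $\mathrm{Th}_\vdash(x)=\{y\in R:x\vdash y\}$, and let $\mathrm{Th}^p(\vdash)=\{\mathrm{Th}_\vdash(x):x\in R\}$. Define $\mathrm{Th}_\vdash(x)+^\vdash\mathrm{Th}_\vdash(y)=\mathrm{Th}_\vdash(x+y)$. Then $+^\vdash$ is well defined, $\langle\mathrm{Th}^p(\vdash),\subseteq,+^\vdash,\mathrm{Th}_\vdash(0)\rangle$ is a dually integral pomonoid, and the map $\mathrm{Th}_\vdash\colon R\to\mathrm{Th}^p(\vdash)$ is a surjective morphism (order-preserving monoid homomorphism).
   Context: A dually integral Abelian pomonoid is $\langle R,\leq,+,0\rangle$ where $\langle R,+,0\rangle$ is a commutative monoid, $\leq$ is a partial order with $a\leq b\Rightarrow a+c\leq b+c$, and $0$ is the least element. A deductive relation on it is a relation $\vdash$ on $R$ such that: $a\leq b$ implies $b\vdash a$; $a\vdash b$ and $b\vdash c$ imply $a\vdash c$; $a\vdash b$ implies $a+c\vdash b+c$. A dually integral pomonoid means a monoid with a compatible partial order whose unit is the least element. *)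

theory Defs
  imports "HOL-Algebra.Group"
begin

text \<open>
  Ordered monoids extend the monoid records of HOL-Algebra, so the operation \<open>+\<close> and the
  unit \<open>0\<close> of the mathematical text appear as \<open>\<otimes>\<close> and \<open>\<one>\<close>. Order and deductive relations are
  predicates on the whole type; only their values on the carrier matter.
\<close>

record 'a pomonoid = "'a monoid" +
  leq :: "'a \<Rightarrow> 'a \<Rightarrow> bool" (infix \<open>\<preceq>\<index>\<close> 50)

locale dually_integral_pomonoid = monoid R for R (structure) +
  assumes order: "partial_order_on (carrier R) (relation_of (leq R) (carrier R))"
    and mult_right_mono:
      "\<lbrakk>a \<in> carrier R; b \<in> carrier R; c \<in> carrier R; a \<preceq> b\<rbrakk> \<Longrightarrow> a \<otimes> c \<preceq> b \<otimes> c"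
    and mult_left_mono:
      "\<lbrakk>a \<in> carrier R; b \<in> carrier R; c \<in> carrier R; a \<preceq> b\<rbrakk> \<Longrightarrow> c \<otimes> a \<preceq> c \<otimes> b"
    and one_least: "a \<in> carrier R \<Longrightarrow> \<one> \<preceq> a"

locale dually_integral_abelian_pomonoid = comm_monoid R for R (structure) +
  assumes order: "partial_order_on (carrier R) (relation_of (leq R) (carrier R))"
    and mult_mono:
      "\<lbrakk>a \<in> carrier R; b \<in> carrier R; c \<in> carrier R; a \<preceq> b\<rbrakk> \<Longrightarrow> a \<otimes> c \<preceq> b \<otimes> c"
    and one_least: "a \<in> carrier R \<Longrightarrow> \<one> \<preceq> a"

locale deductive_relation = dually_integral_abelian_pomonoid R for R (structure) +
  fixes entails :: "'a \<Rightarrow> 'a \<Rightarrow> bool" (infix \<open>\<turnstile>\<close> 50)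
  assumes entails_if_leq: "\<lbrakk>a \<in> carrier R; b \<in> carrier R; a \<preceq> b\<rbrakk> \<Longrightarrow> b \<turnstile> a"
    and entails_trans:
      "\<lbrakk>a \<in> carrier R; b \<in> carrier R; c \<in> carrier R; a \<turnstile> b; b \<turnstile> c\<rbrakk> \<Longrightarrow> a \<turnstile> c"
    and entails_mult:
      "\<lbrakk>a \<in> carrier R; b \<in> carrier R; c \<in> carrier R; a \<turnstile> b\<rbrakk> \<Longrightarrow> a \<otimes> c \<turnstile> b \<otimes> c"

definition Th :: "('a, 'm) pomonoid_scheme \<Rightarrow> ('a \<Rightarrow> 'a \<Rightarrow> bool) \<Rightarrow> 'a \<Rightarrow> 'a set" where
  "Th R ent x = {y \<in> carrier R. ent x y}"

definition principal_theories ::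
    "('a, 'm) pomonoid_scheme \<Rightarrow> ('a \<Rightarrow> 'a \<Rightarrow> bool) \<Rightarrow> 'a set set" where
  "principal_theories R ent = {Th R ent x | x. x \<in> carrier R}"

text \<open>
  The stipulation that the sum of the theories of \<open>x\<close> and \<open>y\<close> is the theory of \<open>x + y\<close> is first
  recorded as a relation between theories, so that its well-definedness can be stated; the
  operation is then the function with this graph.
\<close>

definition is_theory_sum ::
    "('a, 'm) pomonoid_scheme \<Rightarrow> ('a \<Rightarrow> 'a \<Rightarrow> bool) \<Rightarrow> 'a set \<Rightarrow> 'a set \<Rightarrow> 'a set \<Rightarrow> bool" where
  "is_theory_sum R ent X Y Z \<longleftrightarrow>
    (\<exists>x \<in> carrier R. \<exists>y \<in> carrier R.
      X = Th R ent x \<and> Y = Th R ent y \<and> Z = Th R ent (x \<otimes>\<^bsub>R\<^esub> y))"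

definition theory_sum ::
    "('a, 'm) pomonoid_scheme \<Rightarrow> ('a \<Rightarrow> 'a \<Rightarrow> bool) \<Rightarrow> 'a set \<Rightarrow> 'a set \<Rightarrow> 'a set" where
  "theory_sum R ent X Y = (THE Z. is_theory_sum R ent X Y Z)"

definition theory_pomonoid ::
    "('a, 'm) pomonoid_scheme \<Rightarrow> ('a \<Rightarrow> 'a \<Rightarrow> bool) \<Rightarrow> 'a set pomonoid" where
  "theory_pomonoid R ent =
    \<lparr>carrier = principal_theories R ent, mult = theory_sum R ent,
     one = Th R ent \<one>\<^bsub>R\<^esub>, leq = (\<subseteq>)\<rparr>"

text \<open>
  The library's \<open>hom\<close> only requires compatibility with the binary operation, so preservation of
  the unit is added.
\<close>

definition pomonoid_morphism ::
    "('a, 'm) pomonoid_scheme \<Rightarrow> ('b, 'n) pomonoid_scheme \<Rightarrow> ('a \<Rightarrow> 'b) \<Rightarrow> bool" where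
  "pomonoid_morphism R S h \<longleftrightarrow>
    h \<in> hom R S \<and> h \<one>\<^bsub>R\<^esub> = \<one>\<^bsub>S\<^esub> \<and> monotone_on (carrier R) (leq R) (leq S) h"

end

theory Submission
  imports Defs
begin

text \<open>
  Entailment is a preorder, so \<open>Th y \<subseteq> Th x\<close> holds exactly when \<open>x \<turnstile> y\<close>. Hence the principal
  theories are the quotient of \<open>R\<close> by mutual entailment, ordered by the converse of entailment;
  since entailment is compatible with the operation, all the structure descends along \<open>Th\<close>.
\<close>

context deductive_relation
begin

lemma entails_refl: "a \<in> carrier R \<Longrightarrow> a \<turnstile> a"
  using order by (auto intro!: entails_if_leq
      simp: partial_order_on_def preorder_on_def refl_on_def relation_of_def)

text \<open>Reflexivity puts \<open>y\<close> into \<open>Th y\<close>, so the inclusion yields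
  \<open>x \<turnstile> y\<close>; the converse is transitivity.\<close>

lemma Th_subset_iff:
  assumes "x \<in> carrier R" "y \<in> carrier R"
  shows "Th R (\<turnstile>) y \<subseteq> Th R (\<turnstile>) x \<longleftrightarrow> x \<turnstile> y"
  using assms entails_refl entails_trans unfolding Th_def by blast

text \<open>The two factors are replaced one at a time; commutativity turns the right-sided
  \<open>entails_mult\<close> into the left-sided version needed for the second.\<close>

lemma entails_mult_both:
  assumes "a \<in> carrier R" "b \<in> carrier R" "c \<in> carrier R" "d \<in> carrier R" "a \<turnstile> b" "c \<turnstile> d"
  shows "a \<otimes> c \<turnstile> b \<otimes> d"
proof -
  have "a \<otimes> c \<turnstile> b \<otimes> c" "c \<otimes> b \<turnstile> d \<otimes> b"
    using assms by (auto intro: entails_mult)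
  then show ?thesis
    using assms entails_trans[of "a \<otimes> c" "b \<otimes> c" "b \<otimes> d"] by (simp add: m_comm)
qed

lemma Th_mult_mono:
  assumes "x \<in> carrier R" "y \<in> carrier R" "x' \<in> carrier R" "y' \<in> carrier R"
    and "Th R (\<turnstile>) x \<subseteq> Th R (\<turnstile>) x'" "Th R (\<turnstile>) y \<subseteq> Th R (\<turnstile>) y'"
  shows "Th R (\<turnstile>) (x \<otimes> y) \<subseteq> Th R (\<turnstile>) (x' \<otimes> y')"
  using assms by (simp add: Th_subset_iff entails_mult_both)

text \<open>This is the independence of representatives: equal theories include each other, so
  \<open>Th_mult_mono\<close> applied in both directions gives equal sums.\<close>

lemma is_theory_sum_Th_iff:
  assumes "x \<in> carrier R" "y \<in> carrier R"
  shows "is_theory_sum R (\<turnstile>) (Th R (\<turnstile>) x) (Th R (\<turnstile>) y) Z \<longleftrightarrow> Z = Th R (\<turnstile>) (x \<otimes> y)"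
proof
  assume "is_theory_sum R (\<turnstile>) (Th R (\<turnstile>) x) (Th R (\<turnstile>) y) Z"
  then obtain x' y' where "x' \<in> carrier R" "y' \<in> carrier R" "Th R (\<turnstile>) x = Th R (\<turnstile>) x'"
    "Th R (\<turnstile>) y = Th R (\<turnstile>) y'" "Z = Th R (\<turnstile>) (x' \<otimes> y')"
    unfolding is_theory_sum_def by blast
  with assms show "Z = Th R (\<turnstile>) (x \<otimes> y)"
    by (simp add: Th_mult_mono subset_antisym)
next
  assume "Z = Th R (\<turnstile>) (x \<otimes> y)"
  with assms show "is_theory_sum R (\<turnstile>) (Th R (\<turnstile>) x) (Th R (\<turnstile>) y) Z"
    unfolding is_theory_sum_def by blast
qed

lemma theory_sum_Th:
  assumes "x \<in> carrier R" "y \<in> carrier R"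
  shows "theory_sum R (\<turnstile>) (Th R (\<turnstile>) x) (Th R (\<turnstile>) y) = Th R (\<turnstile>) (x \<otimes> y)"
  using assms by (simp add: theory_sum_def is_theory_sum_Th_iff)

lemma principal_theories_eq_image: "principal_theories R (\<turnstile>) = Th R (\<turnstile>) ` carrier R"
  unfolding principal_theories_def by blast

lemma theory_pomonoid_simps:
  "carrier (theory_pomonoid R (\<turnstile>)) = Th R (\<turnstile>) ` carrier R"
  "mult (theory_pomonoid R (\<turnstile>)) = theory_sum R (\<turnstile>)"
  "one (theory_pomonoid R (\<turnstile>)) = Th R (\<turnstile>) \<one>"
  "leq (theory_pomonoid R (\<turnstile>)) = (\<subseteq>)"
  by (simp_all add: theory_pomonoid_def principal_theories_eq_image)

lemma Th_one_subset: "x \<in> carrier R \<Longrightarrow> Th R (\<turnstile>) \<one> \<subseteq> Th R (\<turnstile>) x"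
  by (simp add: Th_subset_iff entails_if_leq one_least)

lemma dually_integral_pomonoid_theory_pomonoid:
  "dually_integral_pomonoid (theory_pomonoid R (\<turnstile>))"
proof -
  have "partial_order_on A (relation_of (\<subseteq>) A)" for A :: "'a set set"
    by (auto simp: partial_order_on_def preorder_on_def refl_on_def trans_def antisym_def
        relation_of_def)
  \<comment> \<open>Inclusions are proved elementwise, so both inclusion lemmas are rotated to have
    the membership as major premise. In the monotonicity axioms one of the two inclusions of
    \<open>Th_mult_mono\<close> is trivial.\<close>
  then show ?thesis
    by unfold_locales
      (auto simp: theory_pomonoid_simps theory_sum_Th m_assoc
        dest: Th_mult_mono[THEN subsetD, rotated 6] Th_one_subset[THEN subsetD, rotated])
qed

text \<open>Two reversals cancel: \<open>x \<preceq> y\<close> gives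
  \<open>y \<turnstile> x\<close>, which means \<open>Th x \<subseteq> Th y\<close>.\<close>

lemma pomonoid_morphism_Th: "pomonoid_morphism R (theory_pomonoid R (\<turnstile>)) (Th R (\<turnstile>))"
  by (simp add: pomonoid_morphism_def hom_def theory_pomonoid_simps theory_sum_Th
      monotone_on_def Th_subset_iff entails_if_leq)

end

theorem theorem3p13:
  fixes R :: "('a, 'm) pomonoid_scheme" and ent :: "'a \<Rightarrow> 'a \<Rightarrow> bool"
  assumes "deductive_relation R ent"
  shows "(\<forall>X \<in> principal_theories R ent. \<forall>Y \<in> principal_theories R ent.
            \<exists>!Z. is_theory_sum R ent X Y Z)
       \<and> dually_integral_pomonoid (theory_pomonoid R ent)
       \<and> pomonoid_morphism R (theory_pomonoid R ent) (Th R ent)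
       \<and> Th R ent ` carrier R = carrier (theory_pomonoid R ent)"
proof -
  interpret deductive_relation R ent
    by (fact assms)
  show ?thesis
    \<comment> \<open>Once theories are written as \<open>Th x\<close> and \<open>Th y\<close>,
      unique existence reduces to that of a \<open>Z\<close> equal to a fixed set.\<close>
    by (simp add: Ex1_def principal_theories_eq_image is_theory_sum_Th_iff theory_pomonoid_simps
        dually_integral_pomonoid_theory_pomonoid pomonoid_morphism_Th)
qed

end
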